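(* Let $E$ be the elliptic curve $y^2=x^3+(ax+b)^2$ with $a,b\in\mathbb{Z}$, $b>0$, $4a^3\neq 27b$, and such that writing $b=b_1b_3^3$ with $b_1$ cubefree we have $\gcd(a,b_3)=1$. Let $\alpha:E(\mathbb{Q})\to\mathbb{Q}^*/{\mathbb{Q}^*}^3$ be defined by $\alpha(O)=1$, $\alpha((0,b))=1/(2b)$, and $\alpha((x,y))=y-(ax+b)$ (modulo cubes) for all other points. (1) A class $\bar u\in\mathbb{Q}^*/{\mathbb{Q}^*}^3$ belongs to the image of $\alpha$ if and only if for some (equivalently, for any) representative $u\in\mathbb{Q}^*$ the homogeneous cubic equation $$uX^3+(1/u)Y^3+2bZ^3-2aXYZ=0$$ has a nontrivial integer (equivalently, rational) solution. (2) More precisely: for $u=1$ it has the solution $(X,Y,Z)=(1,-1,0)$; for $u=1/(2b)$ it has the solution $(0,1,-1)$; and if $(x,y)\in E(\mathbb{Q})$ and $z\in\mathbb{Q}^*$ satisfy $y-(ax+b)=uz^3$, it has the solution $(X,Y,Z)=(z^2,-x,z)$. Conversely, if $(X,Y,Z)$ is a solution with $Z\neq0$, then $(x,y)=\big(-XY/Z^2,\ (uX^3-(1/u)Y^3)/(2Z^3)\big)$ is a point of $E(\mathbb{Q})$ with $y-(ax+b)=u(X/Z)^3$; in particular it is a preimage of $\bar u$ under $\alpha$. (3) If the cubic has a nontrivial rational solution and $u$ is the unique positive cubefree integer representative of $\bar u$, written $u=u_1^2u_2$ with $u_1,u_2$ squarefree and coprime, then $u_1u_2\mid 2b$, and the solubility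 of the cubic is equivalent to that of $$u_1X^3+u_2Y^3+\frac{2b}{u_1u_2}Z^3-2aXYZ=0.$$
   Context: $O$ is the point at infinity of $E$. A solution of a homogeneous equation means a nontrivial one (not all variables zero). *)

theory Defs
  imports "HOL-Algebra.Coset" "HOL-Computational_Algebra.Computational_Algebra"
begin

definition cubefree :: "'a :: comm_monoid_mult \<Rightarrow> bool" where
  "cubefree n \<longleftrightarrow> (\<forall>x. x ^ 3 dvd n \<longrightarrow> x dvd 1)"

definition Q_units :: "rat monoid" where
  "Q_units = \<lparr>carrier = {q. q \<noteq> 0}, monoid.mult = (*), one = 1\<rparr>"

definition Q_cubes :: "rat set" where
  "Q_cubes = {q ^ 3 | q. q \<noteq> 0}"

text \<open>The elements of this quotient are cosets, so the representatives of a class are its members.\<close>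

definition Q_mod_cubes :: "rat set monoid" where
  "Q_mod_cubes = Q_units Mod Q_cubes"

definition cube_class :: "rat \<Rightarrow> rat set" where
  "cube_class u = Q_cubes #>\<^bsub>Q_units\<^esub> u"

datatype point = Infinity | Affine rat rat

definition curve_points :: "int \<Rightarrow> int \<Rightarrow> point set" where
  "curve_points a b =
     {Infinity} \<union> {Affine x y | x y. y ^ 2 = x ^ 3 + (of_int a * x + of_int b) ^ 2}"

fun alpha :: "int \<Rightarrow> int \<Rightarrow> point \<Rightarrow> rat set" where
  "alpha a b Infinity = cube_class 1"
| "alpha a b (Affine x y) =
     (if x = 0 \<and> y = of_int b then cube_class (1 / (2 * of_int b))
      else cube_class (y - (of_int a * x + of_int b)))"

definition ternary_cubic :: "rat \<Rightarrow> rat \<Rightarrow> rat \<Rightarrow> rat \<Rightarrow> rat \<times> rat \<times> rat \<Rightarrow> rat" where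
  "ternary_cubic c1 c2 c3 d = (\<lambda>(X, Y, Z). c1 * X ^ 3 + c2 * Y ^ 3 + c3 * Z ^ 3 - d * X * Y * Z)"

definition descent_cubic :: "int \<Rightarrow> int \<Rightarrow> rat \<Rightarrow> rat \<times> rat \<times> rat \<Rightarrow> rat" where
  "descent_cubic a b u = ternary_cubic u (1 / u) (2 * of_int b) (2 * of_int a)"

definition reduced_cubic :: "int \<Rightarrow> int \<Rightarrow> int \<Rightarrow> int \<Rightarrow> rat \<times> rat \<times> rat \<Rightarrow> rat" where
  "reduced_cubic a b u1 u2 =
     ternary_cubic (of_int u1) (of_int u2) (2 * of_int b / (of_int u1 * of_int u2)) (2 * of_int a)"

definition is_solution :: "(rat \<times> rat \<times> rat \<Rightarrow> rat) \<Rightarrow> rat \<times> rat \<times> rat \<Rightarrow> bool" where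
  "is_solution F P \<longleftrightarrow> P \<noteq> (0, 0, 0) \<and> F P = 0"

definition soluble_in :: "rat set \<Rightarrow> (rat \<times> rat \<times> rat \<Rightarrow> rat) \<Rightarrow> bool" where
  "soluble_in S F \<longleftrightarrow> (\<exists>P \<in> S \<times> S \<times> S. is_solution F P)"

abbreviation soluble_rat :: "(rat \<times> rat \<times> rat \<Rightarrow> rat) \<Rightarrow> bool" where
  "soluble_rat \<equiv> soluble_in UNIV"

abbreviation soluble_int :: "(rat \<times> rat \<times> rat \<Rightarrow> rat) \<Rightarrow> bool" where
  "soluble_int \<equiv> soluble_in \<int>"

lemma comm_group_Q_units: "comm_group Q_units"
  by (rule comm_groupI) (auto simp: Q_units_def intro: exI[of _ "inverse _"])

lemma subgroup_Q_cubes: "subgroup Q_cubes Q_units"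
proof -
  interpret comm_group Q_units by (rule comm_group_Q_units)
  show ?thesis
  proof (rule subgroupI)
    fix c assume c: "c \<in> Q_cubes"
    then obtain q where q: "q \<noteq> 0" "c = q ^ 3" by (auto simp: Q_cubes_def)
    have "inv\<^bsub>Q_units\<^esub> c = inverse c"
      by (rule inv_equality) (use q in \<open>auto simp: Q_units_def\<close>)
    with q show "inv\<^bsub>Q_units\<^esub> c \<in> Q_cubes"
      by (auto simp: Q_cubes_def power_inverse intro!: exI[of _ "inverse q"])
  next
    fix c d assume "c \<in> Q_cubes" "d \<in> Q_cubes"
    then obtain q r where "q \<noteq> 0" "c = q ^ 3" "r \<noteq> 0" "d = r ^ 3"
      by (auto simp: Q_cubes_def)
    then show "c \<otimes>\<^bsub>Q_units\<^esub> d \<in> Q_cubes"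
      by (auto simp: Q_cubes_def Q_units_def power_mult_distrib intro!: exI[of _ "q * r"])
  qed (auto simp: Q_units_def Q_cubes_def intro: exI[of _ 1])
qed

lemma cube_class_in_carrier: "u \<noteq> 0 \<Longrightarrow> cube_class u \<in> carrier Q_mod_cubes"
  by (auto simp: Q_mod_cubes_def FactGroup_def RCOSETS_def cube_class_def Q_units_def)

lemma alpha_in_carrier:
  assumes "b > 0" "P \<in> curve_points a b"
  shows "alpha a b P \<in> carrier Q_mod_cubes"
proof (cases P)
  case Infinity
  then show ?thesis by (simp add: cube_class_in_carrier)
next
  case (Affine x y)
  with assms have "y ^ 2 = x ^ 3 + (of_int a * x + of_int b) ^ 2"
    by (auto simp: curve_points_def)
  then have "x = 0 \<and> y = of_int b" if "y - (of_int a * x + of_int b) = 0"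
    using that by auto
  with assms(1) Affine show ?thesis by (auto intro!: cube_class_in_carrier)
qed

end

theory Submission
  imports Defs
begin

text \<open>
  The curve equation reads \<open>(y - (ax + b)) (y + (ax + b)) = x ^ 3\<close>; writing the first factor as
  \<open>u (X/Z) ^ 3\<close> and \<open>x = -XY/Z ^ 2\<close> forces the second to be \<open>-(1/u) (Y/Z) ^ 3\<close>, and the difference of the
  two factors, \<open>2 (ax + b)\<close>, gives the cubic. Solutions with \<open>Z = 0\<close> exist only if \<open>u\<close> is a cube.
  For \<open>u = u1 ^ 2 u2\<close>, substituting \<open>Y = u1 u2 Y'\<close> turns the cubic into \<open>u1 u2\<close> times the reduced one.
  If a prime \<open>p\<close> divides \<open>u1 u2\<close> but not \<open>2b\<close>, then in an integral solution \<open>p\<close> divides \<open>Z\<close>, hence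
  the other two coordinates one after the other, so that no solution is primitive.
\<close>

section \<open>Cube classes and their representatives\<close>

lemma mem_cube_class_iff: "v \<in> cube_class u \<longleftrightarrow> (\<exists>q. q \<noteq> 0 \<and> v = q ^ 3 * u)"
  by (auto simp: cube_class_def r_coset_def Q_units_def Q_cubes_def)

lemma self_mem_cube_class: "u \<in> cube_class u"
  unfolding mem_cube_class_iff by (intro exI[of _ 1]) simp

lemma cube_class_mult_cube:
  assumes "q \<noteq> 0"
  shows "cube_class (q ^ 3 * u) = cube_class u"
proof (intro subset_antisym subsetI)
  fix v assume "v \<in> cube_class (q ^ 3 * u)"
  then obtain r where "r \<noteq> 0" "v = r ^ 3 * (q ^ 3 * u)"
    unfolding mem_cube_class_iff by blast
  with assms show "v \<in> cube_class u"
    unfolding mem_cube_class_iff by (intro exI[of _ "r * q"]) (simp add: power_mult_distrib)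
next
  fix v assume "v \<in> cube_class u"
  then obtain r where "r \<noteq> 0" "v = r ^ 3 * u"
    unfolding mem_cube_class_iff by blast
  with assms show "v \<in> cube_class (q ^ 3 * u)"
    unfolding mem_cube_class_iff by (intro exI[of _ "r / q"]) (simp add: field_simps)
qed

lemma cube_class_eqI: "v \<in> cube_class u \<Longrightarrow> cube_class v = cube_class u"
  using cube_class_mult_cube by (auto simp: mem_cube_class_iff)

lemma carrier_Q_mod_cubesE:
  assumes "U \<in> carrier Q_mod_cubes"
  obtains u where "u \<noteq> 0" "U = cube_class u"
  using assms
  by (auto simp: Q_mod_cubes_def FactGroup_def RCOSETS_def cube_class_def Q_units_def)

lemma carrier_Q_mod_cubes_mem:
  assumes "U \<in> carrier Q_mod_cubes" "u \<in> U"
  shows "u \<noteq> 0" "U = cube_class u"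
proof -
  obtain w where w: "w \<noteq> 0" "U = cube_class w" by (rule carrier_Q_mod_cubesE[OF assms(1)])
  with assms(2) show "u \<noteq> 0" by (auto simp: mem_cube_class_iff)
  show "U = cube_class u" using assms(2) w cube_class_eqI by simp
qed

section \<open>Clearing denominators: rational against integral solubility\<close>

lemma rat_as_int_fraction:
  fixes x :: rat
  obtains m n :: int where "n > 0" "coprime m n" "x * of_int n = of_int m"
proof -
  obtain m n where mn: "quotient_of x = (m, n)" by fastforce
  show thesis
    by (rule that[of n m])
      (use mn quotient_of_denom_pos quotient_of_coprime quotient_of_div[OF mn] in auto)
qed

lemma common_denominator:
  fixes x y z :: rat
  obtains d k l m :: int where
    "d > 0" "x * of_int d = of_int k" "y * of_int d = of_int l" "z * of_int d = of_int m"
proof -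
  obtain k1 d1 where 1: "d1 > 0" "x * of_int d1 = of_int k1" by (rule rat_as_int_fraction)
  obtain k2 d2 where 2: "d2 > 0" "y * of_int d2 = of_int k2" by (rule rat_as_int_fraction)
  obtain k3 d3 where 3: "d3 > 0" "z * of_int d3 = of_int k3" by (rule rat_as_int_fraction)
  show thesis
  proof (rule that[of "d1 * d2 * d3" "k1 * d2 * d3" "k2 * d1 * d3" "k3 * d1 * d2"])
    show "d1 * d2 * d3 > 0" using 1 2 3 by simp
  qed (simp_all add: 1(2)[symmetric] 2(2)[symmetric] 3(2)[symmetric] ac_simps)
qed

lemma ternary_cubic_homogeneous:
  "ternary_cubic c1 c2 c3 d (t * X, t * Y, t * Z) = t ^ 3 * ternary_cubic c1 c2 c3 d (X, Y, Z)"
  by (simp add: ternary_cubic_def power_mult_distrib algebra_simps power3_eq_cube)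

text \<open>The form is homogeneous of degree 3, so multiplying a rational zero by a common
  denominator of its coordinates gives an integral zero. It stays nontrivial because the denominator
  is positive. The coefficients may be arbitrary rationals, so this serves both the descent cubic
  and the reduced one.\<close>

lemma soluble_rat_ternary_cubicE:
  assumes "soluble_rat (ternary_cubic c1 c2 c3 d)"
  obtains k l m :: int where
    "is_solution (ternary_cubic c1 c2 c3 d) (of_int k, of_int l, of_int m)"
proof -
  obtain X Y Z where sol: "is_solution (ternary_cubic c1 c2 c3 d) (X, Y, Z)"
    using assms unfolding soluble_in_def by auto
  obtain e k l m :: int where e: "e > 0"
    "X * of_int e = of_int k" "Y * of_int e = of_int l" "Z * of_int e = of_int m"
    by (rule common_denominator)
  have "is_solution (ternary_cubic c1 c2 c3 d) (of_int e * X, of_int e * Y, of_int e * Z)"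
    using sol e(1) unfolding is_solution_def ternary_cubic_homogeneous by auto
  then show thesis using e that by (simp add: mult.commute)
qed

lemma soluble_int_iff_rat:
  "soluble_int (ternary_cubic c1 c2 c3 d) \<longleftrightarrow> soluble_rat (ternary_cubic c1 c2 c3 d)"
proof
  assume "soluble_rat (ternary_cubic c1 c2 c3 d)"
  then obtain k l m :: int where
    "is_solution (ternary_cubic c1 c2 c3 d) (of_int k, of_int l, of_int m)"
    by (rule soluble_rat_ternary_cubicE)
  then show "soluble_int (ternary_cubic c1 c2 c3 d)"
    unfolding soluble_in_def by (intro bexI) auto
qed (auto simp: soluble_in_def)

section \<open>Solutions of the descent cubic and points of the curve\<close>

lemma soluble_descent_cubic_mult_cube:
  assumes "q \<noteq> 0" "soluble_rat (descent_cubic a b u)"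
  shows "soluble_rat (descent_cubic a b (q ^ 3 * u))"
proof -
  obtain X Y Z where sol: "is_solution (descent_cubic a b u) (X, Y, Z)"
    using assms unfolding soluble_in_def by auto
  \<comment> \<open>The factor \<open>q ^ 3\<close> in the first coefficient is absorbed by
    \<open>X / q\<close>, its inverse in the second by \<open>Y * q\<close>, and the product of the
    coordinates is unchanged.\<close>
  have "descent_cubic a b (q ^ 3 * u) (X / q, Y * q, Z) = descent_cubic a b u (X, Y, Z)"
    using assms(1) by (simp add: descent_cubic_def ternary_cubic_def field_simps)
  with sol assms(1) have "is_solution (descent_cubic a b (q ^ 3 * u)) (X / q, Y * q, Z)"
    by (auto simp: is_solution_def)
  then show ?thesis by (auto simp: soluble_in_def)
qed

lemma soluble_descent_cubic_cong:
  assumes "v \<in> cube_class u" "soluble_rat (descent_cubic a b u)"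
  shows "soluble_rat (descent_cubic a b v)"
  using assms soluble_descent_cubic_mult_cube by (auto simp: mem_cube_class_iff)

lemma descent_solution_of_point:
  assumes "u \<noteq> 0" "z \<noteq> 0" "Affine x y \<in> curve_points a b"
    and "y - (of_int a * x + of_int b) = u * z ^ 3"
  shows "is_solution (descent_cubic a b u) (z ^ 2, - x, z)"
proof -
  define A where "A = of_int a * x + of_int b"
  have "y ^ 2 = x ^ 3 + A ^ 2"
    using assms(3) by (auto simp: curve_points_def A_def)
  moreover have y: "y = A + u * z ^ 3"
    using assms(4) by (simp add: A_def algebra_simps)
  \<comment> \<open>This is \<open>x ^ 3 = (y - A) * (y + A)\<close> with both factors expressed
    through \<open>u * z ^ 3\<close> and \<open>A\<close>.\<close>
  ultimately have "x ^ 3 = u * z ^ 3 * (2 * A + u * z ^ 3)"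
    by (simp add: power2_eq_square algebra_simps)
  then have "descent_cubic a b u (z ^ 2, - x, z) =
      u * z ^ 3 * z ^ 3 - z ^ 3 * (2 * A + u * z ^ 3) + 2 * of_int b * z ^ 3 + 2 * of_int a * x * z ^ 3"
    using assms(1) by (simp add: descent_cubic_def ternary_cubic_def power_mult[symmetric]
        power2_eq_square power3_eq_cube)
  also have "\<dots> = 0"
    by (simp add: A_def algebra_simps)
  finally show ?thesis using assms(2) by (simp add: is_solution_def)
qed

lemma point_of_descent_solution:
  fixes u X Y Z :: rat and a b :: int
  defines "x \<equiv> - (X * Y) / Z ^ 2" and "y \<equiv> (u * X ^ 3 - (1 / u) * Y ^ 3) / (2 * Z ^ 3)"
  assumes "u \<noteq> 0" "Z \<noteq> 0" "b > 0" and sol: "is_solution (descent_cubic a b u) (X, Y, Z)"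
  shows "Affine x y \<in> curve_points a b"
    and "y - (of_int a * x + of_int b) = u * (X / Z) ^ 3"
    and "alpha a b (Affine x y) = cube_class u"
proof -
  define A where "A = of_int a * x + of_int b"
  \<comment> \<open>The two factors of \<open>x ^ 3\<close>: \<open>s\<close> will be
    \<open>y - A\<close> and \<open>t\<close> will be \<open>-(y + A)\<close>. Divided by
    \<open>Z ^ 3\<close>, the cubic says exactly that \<open>s + t + 2 * A\<close> vanishes.\<close>
  define s where "s = u * (X / Z) ^ 3"
  define t where "t = (1 / u) * (Y / Z) ^ 3"
  have "descent_cubic a b u (X, Y, Z) = Z ^ 3 * (s + t + 2 * A)"
    using \<open>Z \<noteq> 0\<close> by (simp add: descent_cubic_def ternary_cubic_def s_def t_def A_def x_def
        power_divide field_simps power2_eq_square power3_eq_cube)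
  with sol \<open>Z \<noteq> 0\<close> have A: "2 * A = - s - t"
    by (simp add: is_solution_def)
  have y: "2 * y = s - t"
    by (simp add: y_def s_def t_def power_divide diff_divide_distrib)
  have st: "x ^ 3 = - (s * t)"
    using \<open>u \<noteq> 0\<close> by (simp add: x_def s_def t_def power_divide power2_eq_square
        power3_eq_cube ac_simps)
  have "4 * y ^ 2 = (2 * y) ^ 2" by (simp add: power2_eq_square)
  also have "\<dots> = 4 * x ^ 3 + (2 * A) ^ 2"
    unfolding y A st by (simp add: power2_eq_square algebra_simps)
  finally have "y ^ 2 = x ^ 3 + A ^ 2" by (simp add: power_mult_distrib)
  then show "Affine x y \<in> curve_points a b"
    by (simp add: curve_points_def A_def)
  show ys: "y - (of_int a * x + of_int b) = u * (X / Z) ^ 3"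
    using A y unfolding A_def[symmetric] s_def[symmetric] by simp
  show "alpha a b (Affine x y) = cube_class u"
  proof (cases "X = 0")
    case True
    then have 0: "x = 0" "y = of_int b" "s = 0"
      using ys by (auto simp: x_def s_def)
    \<comment> \<open>The point is now \<open>(0, b)\<close>, where \<open>alpha\<close> takes its
      exceptional value. The cubic has lost its terms in \<open>X\<close> and shows that
      \<open>2 * b * u\<close> is a cube, so \<open>u\<close> and \<open>1 / (2 * b)\<close> lie in
      the same class.\<close>
    have bu: "2 * of_int b * u = - ((Y / Z) ^ 3)"
      using A 0 \<open>u \<noteq> 0\<close> by (simp add: A_def t_def field_simps)
    then have "Y \<noteq> 0" using \<open>b > 0\<close> \<open>u \<noteq> 0\<close> by auto
    have "u = (- (Y / Z)) ^ 3 * (1 / (2 * of_int b))"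
      using bu \<open>b > 0\<close> \<open>Z \<noteq> 0\<close> by (simp add: field_simps)
    then have "cube_class u = cube_class (1 / (2 * of_int b))"
      using \<open>Y \<noteq> 0\<close> \<open>Z \<noteq> 0\<close> by (simp only:) (rule cube_class_mult_cube, simp)
    with 0 show ?thesis by simp
  next
    case False
    \<comment> \<open>The value \<open>u * (X / Z) ^ 3\<close> of \<open>y - (a * x + b)\<close> is
      nonzero, whereas it would be 0 at the point \<open>(0, b)\<close>.\<close>
    with ys assms have "\<not> (x = 0 \<and> y = of_int b)" by auto
    then have "alpha a b (Affine x y) = cube_class (u * (X / Z) ^ 3)"
      unfolding alpha.simps ys by (simp only: if_False)
    also have "\<dots> = cube_class u"
      using cube_class_mult_cube[of "X / Z" u] False \<open>Z \<noteq> 0\<close> by (simp add: mult.commute)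
    finally show ?thesis .
  qed
qed

lemma soluble_iff_mem_image_alpha:
  assumes "b > 0" "u \<noteq> 0"
  shows "cube_class u \<in> alpha a b ` curve_points a b \<longleftrightarrow> soluble_rat (descent_cubic a b u)"
proof
  assume "cube_class u \<in> alpha a b ` curve_points a b"
  then obtain P where P: "P \<in> curve_points a b" "cube_class u = alpha a b P" by blast
  \<comment> \<open>Solubility depends only on the cube class, so each kind of point may be treated
    with the representative \<open>v\<close> for which a solution is explicit.\<close>
  have "\<exists>v. cube_class u = cube_class v \<and> soluble_rat (descent_cubic a b v)"
  proof (cases P)
    case Infinity
    have "is_solution (descent_cubic a b 1) (1, -1, 0)"
      by (simp add: is_solution_def descent_cubic_def ternary_cubic_def)
    then show ?thesis using Infinity P by (auto simp: soluble_in_def)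
  next
    case (Affine x y)
    show ?thesis
    proof (cases "x = 0 \<and> y = of_int b")
      case True
      have "is_solution (descent_cubic a b (1 / (2 * of_int b))) (0, 1, -1)"
        by (simp add: is_solution_def descent_cubic_def ternary_cubic_def)
      then show ?thesis using True Affine P by (auto simp: soluble_in_def)
    next
      case False
      define v where "v = y - (of_int a * x + of_int b)"
      have "y ^ 2 = x ^ 3 + (of_int a * x + of_int b) ^ 2"
        using P Affine by (auto simp: curve_points_def)
      \<comment> \<open>If \<open>v\<close> were 0, the curve equation would give
        \<open>x ^ 3 = 0\<close> and hence the excluded point \<open>(0, b)\<close>.\<close>
      with False have "v \<noteq> 0" by (auto simp: v_def)
      then have "is_solution (descent_cubic a b v) (1 ^ 2, - x, 1)"
        using P Affine by (intro descent_solution_of_point[where y = y]) (auto simp: v_def)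
      moreover have "cube_class u = cube_class v"
        using False P Affine by (auto simp: v_def)
      ultimately show ?thesis unfolding soluble_in_def by blast
    qed
  qed
  then show "soluble_rat (descent_cubic a b u)"
    using soluble_descent_cubic_cong self_mem_cube_class by blast
next
  assume "soluble_rat (descent_cubic a b u)"
  then obtain X Y Z where sol: "is_solution (descent_cubic a b u) (X, Y, Z)"
    unfolding soluble_in_def by auto
  show "cube_class u \<in> alpha a b ` curve_points a b"
  proof (cases "Z = 0")
    case True
    then have eq: "u ^ 2 * X ^ 3 = - (Y ^ 3)" and nz: "X \<noteq> 0 \<or> Y \<noteq> 0"
      using sol \<open>u \<noteq> 0\<close>
      by (auto simp: is_solution_def descent_cubic_def ternary_cubic_def field_simps power2_eq_square)
    then have "X \<noteq> 0" "Y \<noteq> 0" using \<open>u \<noteq> 0\<close> by auto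
    \<comment> \<open>Here \<open>u ^ 2\<close> is the cube of \<open>-(Y / X)\<close>. Multiplying
      by \<open>u\<close> shows that \<open>u\<close> times a cube is a cube, so the class is
      trivial and comes from the point at infinity.\<close>
    have "u * (- (Y / X)) ^ 3 = u ^ 3"
      using eq \<open>X \<noteq> 0\<close> by (simp add: field_simps power2_eq_square power3_eq_cube)
    then have "cube_class u = cube_class (u ^ 3 * 1)"
      using cube_class_mult_cube[of "- (Y / X)" u] \<open>X \<noteq> 0\<close> \<open>Y \<noteq> 0\<close> by (simp add: mult.commute)
    also have "\<dots> = alpha a b Infinity"
      unfolding cube_class_mult_cube[OF \<open>u \<noteq> 0\<close>] by simp
    finally show ?thesis by (auto simp: curve_points_def)
  next
    case False
    from point_of_descent_solution(1,3)[OF assms(2) False assms(1) sol]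
    show ?thesis by (metis image_eqI)
  qed
qed

section \<open>Cubefree integer representatives\<close>

lemma cubefree_int_representative_unique:
  fixes u v :: int
  assumes "u > 0" "v > 0" "cubefree u" "cubefree v"
    and "(of_int u :: rat) \<in> cube_class (of_int v)"
  shows "u = v"
proof -
  obtain q :: rat where q: "q \<noteq> 0" "of_int u = q ^ 3 * of_int v"
    using assms(5) by (auto simp: mem_cube_class_iff)
  obtain m n :: int where mn: "n > 0" "coprime m n" "q * of_int n = of_int m"
    by (rule rat_as_int_fraction)
  have "(of_int (u * n ^ 3) :: rat) = of_int (m ^ 3 * v)"
    by (simp add: q mn(3)[symmetric] power_mult_distrib)
  then have eq: "u * n ^ 3 = m ^ 3 * v" by (simp only: of_int_eq_iff)
  \<comment> \<open>Since \<open>q = m / n\<close> is in lowest terms, the cube of \<open>n\<close>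
    must divide \<open>v\<close> and the cube of \<open>m\<close> must divide \<open>u\<close>;
    cubefreeness then leaves only units.\<close>
  have "n ^ 3 dvd m ^ 3 * v" "m ^ 3 dvd u * n ^ 3"
    using eq by (metis dvd_triv_left dvd_triv_right)+
  moreover have "coprime (m ^ 3) (n ^ 3)" using mn by simp
  ultimately have "n ^ 3 dvd v" "m ^ 3 dvd u"
    by (simp_all add: coprime_dvd_mult_right_iff coprime_dvd_mult_left_iff coprime_commute)
  then have "is_unit n" "is_unit m" using assms by (auto simp: cubefree_def)
  \<comment> \<open>The case \<open>m = -1\<close> survives here and is excluded by the positivity
    of \<open>u\<close> and \<open>v\<close>.\<close>
  then have "n = 1" "m = 1 \<or> m = -1" using mn by auto
  with eq assms show ?thesis by auto
qed

text \<open>Strong induction on \<open>N\<close>: as long as the cube of a nonunit divides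
  \<open>N\<close>, it is split off, which leaves a smaller positive quotient.\<close>

lemma cubefree_part_exists:
  fixes N :: int
  assumes "N > 0"
  shows "\<exists>c k. c > 0 \<and> k > 0 \<and> cubefree c \<and> N = k ^ 3 * c"
  using assms
proof (induction "nat N" arbitrary: N rule: less_induct)
  case less
  show ?case
  proof (cases "cubefree N")
    case True
    with less.prems show ?thesis by (intro exI[of _ N] exI[of _ 1]) auto
  next
    case False
    then obtain x where x: "x ^ 3 dvd N" "\<not> is_unit x" by (auto simp: cubefree_def)
    \<comment> \<open>The nonunit \<open>x\<close> may be negative; its absolute value keeps the
      quotient and the factor \<open>k\<close> positive.\<close>
    define y where "y = \<bar>x\<bar>"
    have "y ^ 3 dvd N" using x(1) by (simp add: y_def flip: power_abs)
    then obtain M where M: "N = y ^ 3 * M" by blast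
    have "x \<noteq> 0" using x(1) less.prems by auto
    with x(2) have y: "y > 1" by (auto simp: y_def)
    with M less.prems have "M > 0" by (simp add: zero_less_mult_iff)
    moreover have "1 < y ^ 3" using y by simp
    ultimately have "M < N" unfolding M by simp
    with less.hyps[of M] \<open>M > 0\<close> obtain c k
      where "c > 0" "k > 0" "cubefree c" "M = k ^ 3 * c" by auto
    with M y show ?thesis
      by (intro exI[of _ c] exI[of _ "y * k"]) (auto simp: power_mult_distrib)
  qed
qed

lemma cubefree_int_representative:
  assumes "U \<in> carrier Q_mod_cubes"
  shows "\<exists>!u :: int. u > 0 \<and> cubefree u \<and> of_int u \<in> U"
proof -
  obtain w where w: "w \<noteq> 0" "U = cube_class w" by (rule carrier_Q_mod_cubesE[OF assms])
  obtain m n :: int where mn: "n > 0" "coprime m n" "w * of_int n = of_int m"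
    by (rule rat_as_int_fraction)
  have "m \<noteq> 0" using mn w by auto
  then obtain c k where ck: "c > 0" "k > 0" "cubefree c" "\<bar>m\<bar> * n ^ 2 = k ^ 3 * c"
    using cubefree_part_exists[of "\<bar>m\<bar> * n ^ 2"] mn(1) by auto
  obtain s :: int where s: "\<bar>m\<bar> = s ^ 3 * m" "s \<noteq> 0"
    by (rule that[of "if m < 0 then -1 else 1"]) auto
  define q :: rat where "q = of_int (s * n) / of_int k"
  have "of_int k ^ 3 * of_int c = (of_int (\<bar>m\<bar> * n ^ 2) :: rat)"
    by (simp only: ck of_int_mult of_int_power)
  also have "\<dots> = of_int (s * n) ^ 3 * w"
    by (simp add: s(1) mn(3)[symmetric] power2_eq_square power3_eq_cube)
  finally have "of_int k ^ 3 * of_int c = of_int (s * n) ^ 3 * w" .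
  then have "of_int c = q ^ 3 * w"
    using ck(2) by (simp add: q_def power_divide field_simps)
  moreover have "q \<noteq> 0" using s(2) mn(1) ck(2) by (simp add: q_def)
  ultimately have c: "of_int c \<in> U" using w by (auto simp: mem_cube_class_iff)
  show ?thesis
  proof (rule ex1I)
    show "c > 0 \<and> cubefree c \<and> of_int c \<in> U" using ck c by blast
  next
    fix v :: int assume v: "v > 0 \<and> cubefree v \<and> of_int v \<in> U"
    have "U = cube_class (of_int c)" using carrier_Q_mod_cubes_mem[OF assms c] by blast
    with v ck show "v = c" by (intro cubefree_int_representative_unique) auto
  qed
qed

text \<open>The square part \<open>s\<close> and the squarefree part \<open>t\<close> of
  \<open>u\<close> serve as \<open>u1\<close> and \<open>u2\<close>: a square \<open>x ^ 2\<close>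
  dividing \<open>s\<close> would put \<open>x ^ 4\<close> into \<open>u\<close>, and a common
  divisor \<open>x\<close> of \<open>s\<close> and \<open>t\<close> would put \<open>x ^ 3\<close>
  into \<open>u\<close>, so in both cases \<open>x\<close> is a unit.\<close>

lemma cubefree_decomposition:
  fixes u :: int
  assumes "u > 0" "cubefree u"
  shows "\<exists>u1 u2. u = u1 ^ 2 * u2 \<and> squarefree u1 \<and> squarefree u2 \<and> coprime u1 u2"
proof -
  define s where "s = square_part u"
  define t where "t = squarefree_part u"
  have u: "u = s ^ 2 * t"
    using squarefree_decompose[of u] by (simp add: s_def t_def mult.commute)
  have "squarefree s"
    unfolding squarefree_def
  proof (intro allI impI)
    fix x assume "x ^ 2 dvd s"
    then have "(x ^ 2) ^ 2 dvd u" unfolding u by (intro dvd_mult2) (rule dvd_power_same)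
    then have "x ^ 3 dvd u"
      by (rule dvd_trans[rotated]) (simp add: power_mult[symmetric] le_imp_power_dvd)
    with assms show "is_unit x" by (simp add: cubefree_def)
  qed
  moreover have "squarefree t" using assms by (simp add: t_def)
  moreover have "coprime s t"
  proof (rule coprimeI)
    fix x assume "x dvd s" "x dvd t"
    then have "x ^ 2 * x dvd u" unfolding u by (intro mult_dvd_mono dvd_power_same)
    with assms show "is_unit x" by (simp add: cubefree_def power3_eq_cube power2_eq_square)
  qed
  ultimately show ?thesis using u by blast
qed

section \<open>The reduced cubic and the divisibility of \<open>2 * b\<close>\<close>

lemma soluble_descent_iff_reduced:
  assumes "u1 \<noteq> 0" "u2 \<noteq> 0"
  shows "soluble_rat (descent_cubic a b (of_int (u1 ^ 2 * u2))) \<longleftrightarrow>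
    soluble_rat (reduced_cubic a b u1 u2)"
proof -
  define k :: rat where "k = of_int u1 * of_int u2"
  have k: "k \<noteq> 0" using assms by (simp add: k_def)
  \<comment> \<open>With \<open>u = u1 ^ 2 * u2\<close> the coefficients are
    \<open>u = k * u1\<close> and \<open>k ^ 3 / u = k * u2\<close>; the other two terms contain the
    factor \<open>k\<close> as well.\<close>
  have eq: "descent_cubic a b (of_int (u1 ^ 2 * u2)) (X, k * Y, Z) =
      k * reduced_cubic a b u1 u2 (X, Y, Z)" for X Y Z
    using assms by (simp add: descent_cubic_def reduced_cubic_def ternary_cubic_def k_def
        field_simps power2_eq_square power3_eq_cube)
  have "is_solution (descent_cubic a b (of_int (u1 ^ 2 * u2))) (X, k * Y, Z) \<longleftrightarrow>
      is_solution (reduced_cubic a b u1 u2) (X, Y, Z)" for X Y Z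
    unfolding is_solution_def eq using k by auto
  note sol = this
  show ?thesis
  proof
    assume "soluble_rat (descent_cubic a b (of_int (u1 ^ 2 * u2)))"
    then obtain X Y Z where "is_solution (descent_cubic a b (of_int (u1 ^ 2 * u2))) (X, Y, Z)"
      unfolding soluble_in_def by auto
    then have "is_solution (reduced_cubic a b u1 u2) (X, Y / k, Z)"
      using sol[of X "Y / k" Z] k by simp
    then show "soluble_rat (reduced_cubic a b u1 u2)" by (auto simp: soluble_in_def)
  next
    assume "soluble_rat (reduced_cubic a b u1 u2)"
    then obtain X Y Z where "is_solution (reduced_cubic a b u1 u2) (X, Y, Z)"
      unfolding soluble_in_def by auto
    then show "soluble_rat (descent_cubic a b (of_int (u1 ^ 2 * u2)))"
      unfolding sol[symmetric] by (auto simp: soluble_in_def)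
  qed
qed

text \<open>The equation is the reduced cubic multiplied by \<open>v * w\<close>, where
  \<open>v\<close> is whichever of \<open>u1\<close>, \<open>u2\<close> the prime divides. At first
  only \<open>c * Z ^ 3\<close> may fail to be divisible by \<open>p\<close>. Once \<open>p\<close>
  divides \<open>Z\<close>, only the term in \<open>Y ^ 3\<close> may fail to be divisible by
  \<open>p ^ 2\<close>; once \<open>p\<close> divides \<open>Y\<close> too, only the term in
  \<open>X ^ 3\<close> may fail to be divisible by \<open>p ^ 3\<close>.\<close>

lemma cubic_solution_divisible:
  fixes p v w c d X Y Z :: int
  assumes p: "prime p" "p dvd v" "\<not> p ^ 2 dvd v" "\<not> p dvd w" "\<not> p dvd c"
    and eq: "v ^ 2 * w * X ^ 3 + v * w ^ 2 * Y ^ 3 + c * Z ^ 3 - d * v * w * X * Y * Z = 0"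
  shows "p dvd X" "p dvd Y" "p dvd Z"
proof -
  have [simp]: "p \<noteq> 0" using p by auto
  obtain v' where v: "v = p * v'" using p by blast
  have v': "\<not> p dvd v'" using p(3) by (auto simp: v power2_eq_square)
  have "c * Z ^ 3 = p * (d * v' * w * X * Y * Z - p * v' ^ 2 * w * X ^ 3 - v' * w ^ 2 * Y ^ 3)"
    using eq by (simp add: v algebra_simps power2_eq_square)
  then have "p dvd c * Z ^ 3" by simp
  with p show Z: "p dvd Z" by (auto simp: prime_dvd_mult_iff dest: prime_dvd_power)
  then obtain Z' where Z': "Z = p * Z'" by blast
  have "p * (v' * w ^ 2 * Y ^ 3) =
      p * (p * (d * v' * w * X * Y * Z' - v' ^ 2 * w * X ^ 3 - p * c * Z' ^ 3))"
    using eq by (simp add: v Z' algebra_simps power2_eq_square power3_eq_cube)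
  then have "p dvd v' * w ^ 2 * Y ^ 3" by simp
  with p v' show Y: "p dvd Y" by (auto simp: prime_dvd_mult_iff dest: prime_dvd_power)
  then obtain Y' where Y': "Y = p * Y'" by blast
  have "p ^ 2 * (v' ^ 2 * w * X ^ 3) =
      p ^ 2 * (p * (d * v' * w * X * Y' * Z' - p * v' * w ^ 2 * Y' ^ 3 - c * Z' ^ 3))"
    using eq by (simp add: v Z' Y' algebra_simps power2_eq_square power3_eq_cube)
  then have "p dvd v' ^ 2 * w * X ^ 3" by simp
  with p v' show "p dvd X" by (auto simp: prime_dvd_mult_iff dest: prime_dvd_power)
qed

lemma prime_dvd_of_cubic_solution:
  fixes p v w c d X Y Z :: int
  assumes p: "prime p" "p dvd v" "\<not> p ^ 2 dvd v" "\<not> p dvd w"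
    and eq: "v ^ 2 * w * X ^ 3 + v * w ^ 2 * Y ^ 3 + c * Z ^ 3 - d * v * w * X * Y * Z = 0"
    and nz: "(X, Y, Z) \<noteq> (0, 0, 0)"
  shows "p dvd c"
proof (rule ccontr)
  assume c: "\<not> p dvd c"
  define g where "g = gcd X (gcd Y Z)"
  have g: "g \<noteq> 0" using nz by (auto simp: g_def)
  obtain X' Y' Z' where XYZ: "X = g * X'" "Y = g * Y'" "Z = g * Z'"
    unfolding g_def by (metis dvdE dvd_trans gcd_dvd1 gcd_dvd2)
  have "g ^ 3 * (v ^ 2 * w * X' ^ 3 + v * w ^ 2 * Y' ^ 3 + c * Z' ^ 3 - d * v * w * X' * Y' * Z') = 0"
    using eq by (simp add: XYZ algebra_simps power2_eq_square power3_eq_cube)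
  then have eq': "v ^ 2 * w * X' ^ 3 + v * w ^ 2 * Y' ^ 3 + c * Z' ^ 3 - d * v * w * X' * Y' * Z' = 0"
    using g by simp
  \<comment> \<open>As \<open>p\<close> divides all three quotients, \<open>g * p\<close> is a
    common divisor of \<open>X\<close>, \<open>Y\<close>, \<open>Z\<close> and so divides their gcd
    \<open>g\<close>.\<close>
  have "g * p dvd g"
    using cubic_solution_divisible[OF p c eq'] XYZ
    by (subst (2) g_def) (intro gcd_greatest; simp)
  with g have "is_unit p" by (metis dvd_mult_cancel_left mult.right_neutral)
  with p(1) show False by auto
qed

text \<open>No prime occurs in \<open>n\<close> with exponent above 1, so divisibility may be tested
  one prime at a time.\<close>

lemma squarefree_dvdI:
  fixes n m :: int
  assumes "squarefree n" "\<And>p. prime p \<Longrightarrow> p dvd n \<Longrightarrow> p dvd m"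
  shows "n dvd m"
proof (cases "m = 0")
  case False
  have n: "n \<noteq> 0" using assms(1) by auto
  show ?thesis
  proof (rule multiplicity_le_imp_dvd[OF n])
    fix p :: int assume p: "prime p"
    show "multiplicity p n \<le> multiplicity p m"
    proof (cases "p dvd n")
      case True
      have "multiplicity p n \<le> 1"
        using assms(1) n p by (simp add: squarefree_factorial_semiring'')
      also have "1 \<le> multiplicity p m"
        using assms(2)[OF p True] False p by (intro multiplicity_geI) auto
      finally show ?thesis .
    qed (simp add: not_dvd_imp_multiplicity_0)
  qed
qed auto

lemma soluble_reduced_cubic_imp_dvd:
  assumes sf: "squarefree u1" "squarefree u2" "coprime u1 u2"
    and sol: "soluble_rat (reduced_cubic a b u1 u2)"
  shows "u1 * u2 dvd 2 * b"
proof (rule squarefree_dvdI)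
  have nz: "u1 \<noteq> 0" "u2 \<noteq> 0" using sf by auto
  show "squarefree (u1 * u2)" using sf by (simp add: squarefree_mult_coprime)
  obtain X Y Z :: int where XYZ: "is_solution (reduced_cubic a b u1 u2) (of_int X, of_int Y, of_int Z)"
    using sol unfolding reduced_cubic_def by (rule soluble_rat_ternary_cubicE)
  \<comment> \<open>The factor \<open>u1 * u2\<close> clears the denominator of the third
    coefficient and yields an equation between integers.\<close>
  have "(of_int (u1 ^ 2 * u2 * X ^ 3 + u1 * u2 ^ 2 * Y ^ 3 + 2 * b * Z ^ 3 - 2 * a * u1 * u2 * X * Y * Z) :: rat)
      = of_int u1 * of_int u2 * reduced_cubic a b u1 u2 (of_int X, of_int Y, of_int Z)"
    using nz by (simp add: reduced_cubic_def ternary_cubic_def field_simps power2_eq_square)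
  also have "\<dots> = of_int 0" using XYZ by (simp add: is_solution_def)
  finally have eq: "u1 ^ 2 * u2 * X ^ 3 + u1 * u2 ^ 2 * Y ^ 3 + 2 * b * Z ^ 3 - 2 * a * u1 * u2 * X * Y * Z = 0"
    by (simp only: of_int_eq_iff)
  \<comment> \<open>The equation is symmetric under exchanging \<open>u1\<close>, \<open>X\<close>
    with \<open>u2\<close>, \<open>Y\<close>; this form handles the primes that divide
    \<open>u2\<close>.\<close>
  then have eq': "u2 ^ 2 * u1 * Y ^ 3 + u2 * u1 ^ 2 * X ^ 3 + 2 * b * Z ^ 3 - 2 * a * u2 * u1 * Y * X * Z = 0"
    by (simp add: algebra_simps)
  have XYZ0: "(X, Y, Z) \<noteq> (0, 0, 0)" "(Y, X, Z) \<noteq> (0, 0, 0)"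
    using XYZ by (auto simp: is_solution_def)
  fix p :: int assume p: "prime p" "p dvd u1 * u2"
  have sq: "\<not> p ^ 2 dvd u1" "\<not> p ^ 2 dvd u2"
    using sf p(1) by (auto simp: squarefree_def)
  have "\<not> (p dvd u1 \<and> p dvd u2)" using sf(3) p(1) by (meson not_coprimeI not_prime_unit)
  moreover have "p dvd u1 \<or> p dvd u2" using p by (simp add: prime_dvd_mult_iff)
  ultimately show "p dvd 2 * b"
    using prime_dvd_of_cubic_solution[OF p(1) _ sq(1) _ eq XYZ0(1)]
      prime_dvd_of_cubic_solution[OF p(1) _ sq(2) _ eq' XYZ0(2)] by blast
qed

theorem theorem3p1:
  fixes a b b1 b3 :: int
  assumes b_pos: "b > 0"
    and nonsingular: "4 * a ^ 3 \<noteq> 27 * b"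
    and b_decomp: "b = b1 * b3 ^ 3" "cubefree b1"
    and gcd_cond: "gcd a b3 = 1"
  shows
    "(\<forall>U \<in> carrier Q_mod_cubes.
        (U \<in> alpha a b ` curve_points a b \<longleftrightarrow> (\<exists>u\<in>U. soluble_int (descent_cubic a b u))) \<and>
        (U \<in> alpha a b ` curve_points a b \<longleftrightarrow> (\<forall>u\<in>U. soluble_int (descent_cubic a b u))) \<and>
        (U \<in> alpha a b ` curve_points a b \<longleftrightarrow> (\<exists>u\<in>U. soluble_rat (descent_cubic a b u))) \<and>
        (U \<in> alpha a b ` curve_points a b \<longleftrightarrow> (\<forall>u\<in>U. soluble_rat (descent_cubic a b u)))) \<and>
     (is_solution (descent_cubic a b 1) (1, -1, 0) \<and>
      is_solution (descent_cubic a b (1 / (2 * of_int b))) (0, 1, -1) \<and>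
      (\<forall>u x y z :: rat. u \<noteq> 0 \<and> z \<noteq> 0 \<and> Affine x y \<in> curve_points a b \<and>
          y - (of_int a * x + of_int b) = u * z ^ 3 \<longrightarrow>
          is_solution (descent_cubic a b u) (z ^ 2, - x, z)) \<and>
      (\<forall>u X Y Z :: rat. u \<noteq> 0 \<and> Z \<noteq> 0 \<and> is_solution (descent_cubic a b u) (X, Y, Z) \<longrightarrow>
          (let x = - (X * Y) / Z ^ 2; y = (u * X ^ 3 - (1 / u) * Y ^ 3) / (2 * Z ^ 3) in
             Affine x y \<in> curve_points a b \<and>
             y - (of_int a * x + of_int b) = u * (X / Z) ^ 3 \<and>
             alpha a b (Affine x y) = cube_class u))) \<and>
     (\<forall>U \<in> carrier Q_mod_cubes.
        (\<exists>!u :: int. u > 0 \<and> cubefree u \<and> of_int u \<in> U) \<and>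
        (\<forall>u :: int. u > 0 \<and> cubefree u \<and> of_int u \<in> U \<longrightarrow>
           (\<exists>u1 u2 :: int. u = u1 ^ 2 * u2 \<and> squarefree u1 \<and> squarefree u2 \<and> coprime u1 u2) \<and>
           (\<forall>u1 u2 :: int. u = u1 ^ 2 * u2 \<and> squarefree u1 \<and> squarefree u2 \<and> coprime u1 u2 \<longrightarrow>
              (soluble_rat (descent_cubic a b (of_int u)) \<longrightarrow> u1 * u2 dvd 2 * b) \<and>
              (soluble_rat (descent_cubic a b (of_int u)) \<longleftrightarrow> soluble_rat (reduced_cubic a b u1 u2)) \<and>
              (soluble_int (descent_cubic a b (of_int u)) \<longleftrightarrow> soluble_int (reduced_cubic a b u1 u2)))))"
proof (intro conjI)
  have int_rat: "soluble_int (descent_cubic a b u) \<longleftrightarrow> soluble_rat (descent_cubic a b u)"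
    "soluble_int (reduced_cubic a b u1 u2) \<longleftrightarrow> soluble_rat (reduced_cubic a b u1 u2)" for u u1 u2
    unfolding descent_cubic_def reduced_cubic_def by (rule soluble_int_iff_rat)+
  have image: "U \<in> alpha a b ` curve_points a b \<longleftrightarrow> soluble_rat (descent_cubic a b u)"
    if "U \<in> carrier Q_mod_cubes" "u \<in> U" for U u
    using soluble_iff_mem_image_alpha[OF b_pos] carrier_Q_mod_cubes_mem[OF that] by simp
  \<comment> \<open>A class has a member, so solubility for all representatives implies solubility
    for some.\<close>
  have nonempty: "\<exists>u. u \<in> U" if "U \<in> carrier Q_mod_cubes" for U
    by (rule carrier_Q_mod_cubesE[OF that]) (use self_mem_cube_class in auto)
  show "\<forall>U \<in> carrier Q_mod_cubes.
      (U \<in> alpha a b ` curve_points a b \<longleftrightarrow> (\<exists>u\<in>U. soluble_int (descent_cubic a b u))) \<and>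
      (U \<in> alpha a b ` curve_points a b \<longleftrightarrow> (\<forall>u\<in>U. soluble_int (descent_cubic a b u))) \<and>
      (U \<in> alpha a b ` curve_points a b \<longleftrightarrow> (\<exists>u\<in>U. soluble_rat (descent_cubic a b u))) \<and>
      (U \<in> alpha a b ` curve_points a b \<longleftrightarrow> (\<forall>u\<in>U. soluble_rat (descent_cubic a b u)))"
    (is "\<forall>U\<in>_. _ U \<and> _ U \<and> ?P U \<and> ?Q U")
    unfolding int_rat
  proof
    fix U assume U: "U \<in> carrier Q_mod_cubes"
    from nonempty[OF U] obtain u where "u \<in> U" by blast
    with image[OF U] show "?P U \<and> ?Q U \<and> ?P U \<and> ?Q U" by blast
  qed
  show "is_solution (descent_cubic a b 1) (1, -1, 0)"
    "is_solution (descent_cubic a b (1 / (2 * of_int b))) (0, 1, -1)"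
    by (simp_all add: is_solution_def descent_cubic_def ternary_cubic_def)
  show "\<forall>u x y z :: rat. u \<noteq> 0 \<and> z \<noteq> 0 \<and> Affine x y \<in> curve_points a b \<and>
      y - (of_int a * x + of_int b) = u * z ^ 3 \<longrightarrow>
      is_solution (descent_cubic a b u) (z ^ 2, - x, z)"
    by (intro allI impI, elim conjE) (rule descent_solution_of_point)
  show "\<forall>u X Y Z :: rat. u \<noteq> 0 \<and> Z \<noteq> 0 \<and> is_solution (descent_cubic a b u) (X, Y, Z) \<longrightarrow>
      (let x = - (X * Y) / Z ^ 2; y = (u * X ^ 3 - (1 / u) * Y ^ 3) / (2 * Z ^ 3) in
         Affine x y \<in> curve_points a b \<and>
         y - (of_int a * x + of_int b) = u * (X / Z) ^ 3 \<and>
         alpha a b (Affine x y) = cube_class u)"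
    unfolding Let_def
    by (intro allI impI conjI; elim conjE) (rule point_of_descent_solution[OF _ _ b_pos]; assumption)+
  show "\<forall>U \<in> carrier Q_mod_cubes.
      (\<exists>!u :: int. u > 0 \<and> cubefree u \<and> of_int u \<in> U) \<and>
      (\<forall>u :: int. u > 0 \<and> cubefree u \<and> of_int u \<in> U \<longrightarrow>
         (\<exists>u1 u2 :: int. u = u1 ^ 2 * u2 \<and> squarefree u1 \<and> squarefree u2 \<and> coprime u1 u2) \<and>
         (\<forall>u1 u2 :: int. u = u1 ^ 2 * u2 \<and> squarefree u1 \<and> squarefree u2 \<and> coprime u1 u2 \<longrightarrow>
            (soluble_rat (descent_cubic a b (of_int u)) \<longrightarrow> u1 * u2 dvd 2 * b) \<and>
            (soluble_rat (descent_cubic a b (of_int u)) \<longleftrightarrow> soluble_rat (reduced_cubic a b u1 u2)) \<and>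
            (soluble_int (descent_cubic a b (of_int u)) \<longleftrightarrow> soluble_int (reduced_cubic a b u1 u2))))"
  proof (intro ballI conjI[OF cubefree_int_representative] allI impI; (elim conjE)?)
    fix U and u :: int
    assume u: "u > 0" "cubefree u"
    have "(soluble_rat (descent_cubic a b (of_int u)) \<longrightarrow> u1 * u2 dvd 2 * b) \<and>
        (soluble_rat (descent_cubic a b (of_int u)) \<longleftrightarrow> soluble_rat (reduced_cubic a b u1 u2)) \<and>
        (soluble_int (descent_cubic a b (of_int u)) \<longleftrightarrow> soluble_int (reduced_cubic a b u1 u2))"
      if "u = u1 ^ 2 * u2" "squarefree u1" "squarefree u2" "coprime u1 u2" for u1 u2 :: int
    proof -
      \<comment> \<open>Both are nonzero because \<open>u\<close> is positive. \<open>u1\<close> may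
        be negative, and the two lemmas on the reduced cubic allow either sign.\<close>
      have "u1 \<noteq> 0" "u2 \<noteq> 0" using u that(1) by auto
      then have "soluble_rat (descent_cubic a b (of_int u)) \<longleftrightarrow> soluble_rat (reduced_cubic a b u1 u2)"
        unfolding that(1) by (rule soluble_descent_iff_reduced)
      then show ?thesis
        unfolding int_rat using soluble_reduced_cubic_imp_dvd[OF that(2-4)] by simp
    qed
    then show "(\<exists>u1 u2 :: int. u = u1 ^ 2 * u2 \<and> squarefree u1 \<and> squarefree u2 \<and> coprime u1 u2) \<and>
        (\<forall>u1 u2 :: int. u = u1 ^ 2 * u2 \<and> squarefree u1 \<and> squarefree u2 \<and> coprime u1 u2 \<longrightarrow>
            (soluble_rat (descent_cubic a b (of_int u)) \<longrightarrow> u1 * u2 dvd 2 * b) \<and>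
            (soluble_rat (descent_cubic a b (of_int u)) \<longleftrightarrow> soluble_rat (reduced_cubic a b u1 u2)) \<and>
            (soluble_int (descent_cubic a b (of_int u)) \<longleftrightarrow> soluble_int (reduced_cubic a b u1 u2)))"
      using cubefree_decomposition[OF u] by simp
  qed
qed

end
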